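(* We have $E_{Q_5,Q_5}=7$.
   Context: $\mathbb Z_5=\mathbb Z/5\mathbb Z$ and $Q_5=\{1,-1\}$ is the set of non-zero squares in $\mathbb Z_5$. A sequence of length $k$ in $\mathbb Z_5$ is an element of $\mathbb Z_5^k$. A sequence $(x_1,\ldots,x_k)$ in $\mathbb Z_5$ is called a $(Q_5,Q_5)$-weighted zero-sum sequence if there exist $a_1,\ldots,a_k\in Q_5$ and $b_1,\ldots,b_k\in Q_5$ such that $a_1x_1+\cdots+a_kx_k=0$ and $b_1a_1+\cdots+b_ka_k=0$ in $\mathbb Z_5$. The constant $E_{Q_5,Q_5}$ is the least positive integer $k$ such that every sequence in $\mathbb Z_5$ of length $k$ has a $(Q_5,Q_5)$-weighted zero-sum subsequence of length $5$ (terms not necessarily consecutive). *)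

theory Defs
  imports "HOL-Library.Numeral_Type" "HOL-Library.Sublist"
begin

text \<open>
  The ring of integers modulo 5 is the numeral type \<open>5\<close>, whose ring operations are
  arithmetic modulo 5. Sequences are lists; \<^const>\<open>subseq\<close> selects a sublist whose
  terms need not be consecutive.
\<close>

type_synonym Z5 = 5

definition Q5 :: "Z5 set" where
  "Q5 = {y. y \<noteq> 0 \<and> (\<exists>x. y = x ^ 2)}"

lemma Q5_eq: "Q5 = {1, -1}"
proof -
  have cases5: "x = 0 \<or> x = 1 \<or> x = 2 \<or> x = 3 \<or> x = 4" for x :: Z5
  proof (cases x rule: bit1_cases)
    case (of_int z)
    then have "z = 0 \<or> z = 1 \<or> z = 2 \<or> z = 3 \<or> z = 4" by auto
    with of_int show ?thesis by auto
  qed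
  have sq: "x = 0 \<or> x ^ 2 = 1 \<or> x ^ 2 = -1" for x :: Z5
    using cases5[of x] by (auto simp: power2_eq_square)
  have "y \<in> Q5" if "y = 1 \<or> y = -1" for y
  proof -
    have "(1::Z5) = 1 ^ 2" "(-1::Z5) = 2 ^ 2" "(1::Z5) \<noteq> 0" "(-1::Z5) \<noteq> 0" by simp_all
    with that show ?thesis unfolding Q5_def mem_Collect_eq by metis
  qed
  moreover have "y = 1 \<or> y = -1" if "y \<in> Q5" for y
  proof -
    from that obtain x where "y \<noteq> 0" "y = x ^ 2" unfolding Q5_def by blast
    with sq[of x] show ?thesis by auto
  qed
  ultimately show ?thesis by blast
qed

definition weighted_zero_sum :: "'a::comm_ring_1 set \<Rightarrow> 'a set \<Rightarrow> 'a list \<Rightarrow> bool" where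
  "weighted_zero_sum A B xs \<longleftrightarrow>
     (\<exists>as bs. length as = length xs \<and> set as \<subseteq> A \<and>
              length bs = length xs \<and> set bs \<subseteq> B \<and>
              (\<Sum>i<length xs. as ! i * xs ! i) = 0 \<and>
              (\<Sum>i<length xs. bs ! i * as ! i) = 0)"

definition E_const :: "Z5 set \<Rightarrow> Z5 set \<Rightarrow> nat" where
  "E_const A B =
     (LEAST k. 0 < k \<and>
        (\<forall>xs :: Z5 list. length xs = k \<longrightarrow>
           (\<exists>ys. subseq ys xs \<and> length ys = 5 \<and> weighted_zero_sum A B ys)))"

end

theory Submission
  imports Defs "HOL-Library.Multiset"
begin

text \<open>
  Five signs \<open>a\<^sub>i\<close> satisfy \<open>\<Sum>a\<^sub>i\<^sup>2 = 5 = 0\<close>, so for sequences of length 5 the second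
  weighted condition is met by \<open>b = a\<close>, and only the signed sums \<open>\<Sum>\<plusminus>x\<^sub>i\<close> matter.
  A sign multiplies a term without changing its square, and squares take only three values,
  so any four terms contain two which cancel. In a sequence of length 7 with a zero term, two
  cancelling pairs among the other six terms are completed by that zero. Without a zero term,
  each nonzero term enlarges the set of signed sums until it is everything (as in
  Cauchy-Davenport), so any five terms work.
  The sequence \<open>0, 0, 0, 0, 1, 2\<close> shows that length 6 does not suffice.
\<close>

definition add_signed :: "'a::ab_group_add \<Rightarrow> 'a set \<Rightarrow> 'a set" where
  "add_signed x T = (+) x ` T \<union> (+) (- x) ` T"

definition signed_sums :: "'a::ab_group_add list \<Rightarrow> 'a set" where
  "signed_sums xs = foldr add_signed xs {0}"

lemma signed_sums_simps [simp]:
  "signed_sums [] = {0}"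
  "signed_sums (x # xs) = add_signed x (signed_sums xs)"
  by (simp_all add: signed_sums_def)

lemma add_signed_commute: "add_signed x \<circ> add_signed y = add_signed y \<circ> add_signed x"
  by (rule ext) (simp add: add_signed_def image_Un image_image algebra_simps Un_ac)

text \<open>Order is irrelevant because the maps \<open>add_signed x\<close> commute; choices of
  terms can therefore be made among multisets.\<close>

lemma signed_sums_mset_cong:
  assumes "mset xs = mset ys"
  shows "signed_sums xs = signed_sums ys"
proof -
  have "fold add_signed (rev xs) = fold add_signed (rev ys)"
    by (rule fold_multiset_equiv) (simp_all add: add_signed_commute assms)
  then show ?thesis
    by (simp add: signed_sums_def foldr_conv_fold)
qed

lemma signed_sums_iff:
  fixes xs :: "'a::comm_ring_1 list"
  shows "s \<in> signed_sums xs \<longleftrightarrow>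
    (\<exists>as. length as = length xs \<and> set as \<subseteq> {1, -1} \<and> (\<Sum>i<length xs. as ! i * xs ! i) = s)"
proof (induction xs arbitrary: s)
  case Nil
  then show ?case by auto
next
  case (Cons x xs)
  \<comment> \<open>Splitting off the sign \<open>a\<close> of the head leaves
    \<open>s - a * x\<close> to be reached by the tail, where the induction hypothesis
    applies.\<close>
  have "s \<in> signed_sums (x # xs) \<longleftrightarrow> (\<exists>a\<in>{1, -1}. s - a * x \<in> signed_sums xs)"
    by (auto simp: add_signed_def image_iff algebra_simps intro: bexI[rotated])
  also have "\<dots> \<longleftrightarrow> (\<exists>a as. length as = length xs \<and> set (a # as) \<subseteq> {1, -1} \<and>
      (\<Sum>i<length (x # xs). (a # as) ! i * (x # xs) ! i) = s)"
  proof -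
    have "(\<Sum>i<length (x # xs). (a # as) ! i * (x # xs) ! i) = s \<longleftrightarrow>
        (\<Sum>i<length xs. as ! i * xs ! i) = s - a * x" for a as
      by (simp add: sum.lessThan_Suc_shift eq_diff_eq add.commute del: sum.lessThan_Suc)
    then show ?thesis
      unfolding Cons.IH by (simp only: list.set(2) insert_subset) blast
  qed
  also have "\<dots> \<longleftrightarrow> (\<exists>as. length as = length (x # xs) \<and> set as \<subseteq> {1, -1} \<and>
      (\<Sum>i<length (x # xs). as ! i * (x # xs) ! i) = s)"
    by (simp only: length_Cons length_Suc_conv) blast
  finally show ?case .
qed

lemma weighted_zero_sum_iff:
  fixes xs :: "Z5 list"
  assumes "length xs = 5"
  shows "weighted_zero_sum Q5 Q5 xs \<longleftrightarrow> 0 \<in> signed_sums xs"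
proof
  assume "weighted_zero_sum Q5 Q5 xs"
  then show "0 \<in> signed_sums xs"
    unfolding weighted_zero_sum_def signed_sums_iff Q5_eq by blast
next
  assume "0 \<in> signed_sums xs"
  then obtain as where as: "length as = length xs" "set as \<subseteq> Q5"
      "(\<Sum>i<length xs. as ! i * xs ! i) = 0"
    unfolding signed_sums_iff Q5_eq by blast
  have "as ! i * as ! i = 1" if "i < length xs" for i
  proof -
    have "as ! i \<in> {1, -1}"
      using as(1,2) that nth_mem[of i as] unfolding Q5_eq by (metis subsetD)
    then show ?thesis
      by auto
  qed
  then have "(\<Sum>i<length xs. as ! i * as ! i) = of_nat (length xs)"
    by simp
  then have "(\<Sum>i<length xs. as ! i * as ! i) = 0"
    using assms by simp
  with as show "weighted_zero_sum Q5 Q5 xs"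
    unfolding weighted_zero_sum_def by blast
qed

text \<open>Scanning \<open>xs\<close> from the left and keeping each term of which
  \<open>ys\<close> still needs a copy gives \<open>zs\<close>, in general a rearrangement of
  \<open>ys\<close>.\<close>

lemma subseq_of_submset:
  assumes "mset ys \<subseteq># mset xs"
  obtains zs where "subseq zs xs" "mset zs = mset ys"
  using assms
proof (induction xs arbitrary: ys thesis)
  case Nil
  then show ?case by auto
next
  case (Cons x xs)
  show ?case
  proof (cases "x \<in> set ys")
    case True
    then have "mset (remove1 x ys) \<subseteq># mset xs"
      using Cons.prems(2) by (simp add: subset_eq_diff_conv)
    then obtain zs where "subseq zs xs" "mset zs = mset (remove1 x ys)"
      using Cons.IH by blast
    with True show ?thesis
      by (intro Cons.prems(1)[of "x # zs"]) auto
  next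
    case False
    then have "mset ys \<subseteq># mset xs"
      using Cons.prems(2) by (simp add: subseteq_mset_def) (metis count_mset_0_iff le0)
    then obtain zs where "subseq zs xs" "mset zs = mset ys"
      using Cons.IH by blast
    then show ?thesis
      by (intro Cons.prems(1)[of zs]) auto
  qed
qed

lemma Z5_cases: "x = 0 \<or> x = 1 \<or> x = 2 \<or> x = 3 \<or> x = 4" for x :: Z5
proof (cases x rule: bit1_cases)
  case (of_int z)
  then have "z = 0 \<or> z = 1 \<or> z = 2 \<or> z = 3 \<or> z = 4" by auto
  with of_int show ?thesis by auto
qed

lemma Z5_sq_eq_imp: "x ^ 2 = y ^ 2 \<Longrightarrow> x = y \<or> x = - y" for x y :: Z5
  using Z5_cases[of x] Z5_cases[of y] by (auto simp: power2_eq_square)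

lemma obtain_cancelling_pair:
  fixes xs :: "Z5 list"
  assumes "length xs \<ge> 4"
  obtains x y zs where "mset xs = mset (x # y # zs)" "x = y \<or> x = - y"
proof -
  have "set (map (\<lambda>x. x ^ 2) xs) \<subseteq> insert 0 Q5"
    by (auto simp: Q5_def)
  then have "card (set (map (\<lambda>x. x ^ 2) xs)) \<le> card (insert 0 Q5)"
    by (rule card_mono[rotated]) (simp add: Q5_eq)
  also have "\<dots> < length (map (\<lambda>x. x ^ 2) xs)"
    using assms by (simp add: Q5_eq)
  finally have "\<not> distinct (map (\<lambda>x. x ^ 2) xs)"
    using distinct_card by fastforce
  then obtain as bs cs q where "map (\<lambda>x. x ^ 2) xs = as @ [q] @ bs @ [q] @ cs"
    using not_distinct_decomp by blast
  then obtain as' bs' cs' x y where "xs = as' @ [x] @ bs' @ [y] @ cs'" "x ^ 2 = y ^ 2"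
    by (auto simp: map_eq_append_conv append_eq_map_conv map_eq_Cons_conv)
  then show thesis
    using Z5_sq_eq_imp by (intro that[of x y "as' @ bs' @ cs'"]) auto
qed

text \<open>Opposite signs if \<open>x = y\<close>, equal signs if \<open>x = - y\<close>: the two
  terms then contribute 0.\<close>

lemma add_signed_cancel:
  assumes "x = y \<or> x = - y" "s \<in> T"
  shows "s \<in> add_signed x (add_signed y T)"
  using assms by (auto simp: add_signed_def image_Un image_image)

text \<open>Since 5 is prime, any nonzero \<open>d\<close> generates the additive group, so the
  translates of \<open>t\<close> by multiples of \<open>d\<close> exhaust \<open>Z5\<close>.\<close>

lemma Z5_shift_closed_UNIV:
  fixes T :: "Z5 set"
  assumes "t \<in> T" "d \<noteq> 0" and closed: "\<And>s. s \<in> T \<Longrightarrow> s + d \<in> T"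
  shows "T = UNIV"
proof -
  have "y \<in> T" for y
  proof -
    have "{t, t + d, t + d + d, t + d + d + d, t + d + d + d + d} \<subseteq> T"
      using assms by blast
    then have "t + of_nat n * d \<in> T" if "n \<in> {0, 1, 2, 3, 4}" for n
      using that by (auto simp: algebra_simps)
    moreover have "\<exists>n\<in>{0, 1, 2, 3, 4::nat}. y - t = of_nat n * d"
      using Z5_cases[of "y - t"] Z5_cases[of d] \<open>d \<noteq> 0\<close> by auto
    then obtain n where "n \<in> {0, 1, 2, 3, 4::nat}" "y = t + of_nat n * d"
      by (auto simp only: diff_eq_eq add.commute)
    ultimately show ?thesis by blast
  qed
  then show ?thesis by blast
qed

text \<open>If the union is no larger than \<open>T\<close>, it coincides with both translates
  \<open>x + T\<close> and \<open>- x + T\<close>. Then \<open>T\<close> is stable under the shift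
  by \<open>x + x\<close>, which is nonzero as 5 is odd, so \<open>T\<close> is everything.\<close>

lemma card_add_signed:
  fixes T :: "Z5 set"
  assumes "x \<noteq> 0" "T \<noteq> {}"
  shows "card (add_signed x T) \<ge> min 5 (card T + 1)"
proof (cases "card (add_signed x T) \<le> card T")
  case True
  have card_shift: "card ((+) a ` T) = card T" for a :: Z5
    by (simp add: card_image)
  have shift: "(+) a ` T = add_signed x T" if "a \<in> {x, - x}" for a
    using that True by (intro card_seteq) (auto simp: add_signed_def card_shift)
  have "s + (x + x) \<in> T" if "s \<in> T" for s
  proof -
    have "x + s \<in> (+) (- x) ` T"
      using that shift[of x] shift[of "- x"] by blast
    then show ?thesis
      by (auto simp: algebra_simps)
  qed
  moreover have "x + x \<noteq> 0"
    using assms(1) Z5_cases[of x] by auto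
  ultimately have "T = UNIV"
    using assms(2) Z5_shift_closed_UNIV by blast
  then show ?thesis
    using card_shift[of x] shift[of x] by simp
qed simp

lemma card_signed_sums:
  fixes xs :: "Z5 list"
  assumes "0 \<notin> set xs"
  shows "card (signed_sums xs) \<ge> min 5 (length xs + 1)"
  using assms
proof (induction xs)
  case (Cons x xs)
  then have "signed_sums xs \<noteq> {}"
    by auto
  then show ?case
    using card_add_signed[of x "signed_sums xs"] Cons by simp
qed simp

lemma length7_zero_sum:
  fixes xs :: "Z5 list"
  assumes "length xs = 7"
  obtains ys where "mset ys \<subseteq># mset xs" "length ys = 5" "0 \<in> signed_sums ys"
proof (cases "0 \<in> set xs")
  case True
  define us where "us = remove1 0 xs"
  have us: "mset xs = mset (0 # us)" "length us = 6"
    using True assms by (simp_all add: us_def length_remove1)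
  then obtain x y vs where xy: "mset us = mset (x # y # vs)" "x = y \<or> x = - y"
    using obtain_cancelling_pair[of us] by auto
  \<comment> \<open>Exactly the four terms that a second cancelling pair requires.\<close>
  then have "length vs = 4"
    using us(2) mset_eq_length[OF xy(1)] by simp
  then obtain z w ws where zw: "mset vs = mset (z # w # ws)" "z = w \<or> z = - w"
    using obtain_cancelling_pair[of vs] by auto
  have "0 \<in> signed_sums [x, y, z, w, 0]"
    unfolding signed_sums_simps by (intro add_signed_cancel xy zw) (simp add: add_signed_def)
  then show thesis
    using us(1) xy(1) zw(1) by (intro that[of "[x, y, z, w, 0]"]) auto
next
  case False
  define ys where "ys = take 5 xs"
  have "0 \<notin> set ys"
    using False by (auto simp: ys_def dest: in_set_takeD)
  then have "card (signed_sums ys) \<ge> CARD(Z5)"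
    using card_signed_sums[of ys] assms by (simp add: ys_def)
  then have "signed_sums ys = UNIV"
    by (intro card_seteq) auto
  moreover have "mset ys \<subseteq># mset xs"
    by (metis append_take_drop_id mset_append mset_subset_eq_add_left ys_def)
  ultimately show thesis
    using assms by (intro that[of ys]) (auto simp: ys_def)
qed

text \<open>Deleting one term leaves signed sums \<plusminus>1, \<plusminus>2 or
  \<plusminus>1\<plusminus>2, the last being \<plusminus>1 or \<plusminus>3; none vanishes modulo
  5.\<close>

lemma no_zero_sum_subseq:
  fixes ys :: "Z5 list"
  assumes "subseq ys [0, 0, 0, 0, 1, 2]" "length ys = 5"
  shows "0 \<notin> signed_sums ys"
proof -
  \<comment> \<open>\<open>subseqs\<close> lists one entry per choice of positions, so deleting each
    of the four zeros gives its own copy of \<open>[0, 0, 0, 1, 2]\<close>.\<close>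
  have "filter (\<lambda>zs. length zs = 5) (subseqs [0, 0, 0, 0, 1, 2 :: Z5]) =
      [[0, 0, 0, 0, 1], [0, 0, 0, 0, 2]] @ replicate 4 [0, 0, 0, 1, 2]"
    by (simp add: Let_def numeral_eq_Suc)
  moreover have "ys \<in> set (filter (\<lambda>zs. length zs = 5) (subseqs [0, 0, 0, 0, 1, 2]))"
    using assms by (simp only: set_filter in_set_subseqs mem_Collect_eq)
  ultimately have "ys = [0, 0, 0, 0, 1] \<or> ys = [0, 0, 0, 0, 2] \<or> ys = [0, 0, 0, 1, 2]"
    by auto
  then show ?thesis
    by (auto simp: add_signed_def)
qed

theorem theorem5p2: "E_const Q5 Q5 = 7"
  unfolding E_const_def
proof (rule Least_equality, intro conjI allI impI)
  fix xs :: "Z5 list"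
  assume "length xs = 7"
  then obtain ys where ys: "mset ys \<subseteq># mset xs" "length ys = 5" "0 \<in> signed_sums ys"
    by (rule length7_zero_sum)
  then obtain zs where zs: "subseq zs xs" "mset zs = mset ys"
    using subseq_of_submset by blast
  then have "length zs = 5" "0 \<in> signed_sums zs"
    using ys mset_eq_length[OF zs(2)] signed_sums_mset_cong[OF zs(2)] by simp_all
  with zs(1) show "\<exists>ys. subseq ys xs \<and> length ys = 5 \<and> weighted_zero_sum Q5 Q5 ys"
    using weighted_zero_sum_iff by blast
next
  fix k
  assume k: "0 < k \<and> (\<forall>xs :: Z5 list. length xs = k \<longrightarrow>
    (\<exists>ys. subseq ys xs \<and> length ys = 5 \<and> weighted_zero_sum Q5 Q5 ys))"
  show "7 \<le> k"
  proof (rule ccontr)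
    \<comment> \<open>Its prefixes refute every \<open>k\<close> below 7 at once: a subsequence of a
      prefix is one of \<open>xs\<close>, and the length 6 makes \<open>take k xs\<close> have
      length exactly \<open>k\<close>.\<close>
    define xs :: "Z5 list" where "xs = [0, 0, 0, 0, 1, 2]"
    assume "\<not> 7 \<le> k"
    then have "length (take k xs) = k"
      by (simp add: xs_def)
    with k obtain ys where ys: "subseq ys (take k xs)" "length ys = 5"
        "weighted_zero_sum Q5 Q5 ys"
      by blast
    have "subseq ys xs"
      using ys(1) by (rule subseq_order.trans) (rule prefix_imp_subseq, rule take_is_prefix)
    then show False
      using ys no_zero_sum_subseq weighted_zero_sum_iff by (simp add: xs_def)
  qed
qed simp

end
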